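(* Let $X=(x_{st})_{n\times n}$ be a symmetric matrix of order $n$ over the complex field. For $1\le i,j\le n$ let $X_{[ij]}$ be the symmetric matrix obtained from $X$ by replacing the $(i,j)$-entry and the $(j,i)$-entry with $0$. Then the permanent of $X$ satisfies $$\frac{1}{2}(n^2-n)\,\mathrm{per}(X)=\sum_{1\le i\le j\le n}\mathrm{per}(X_{[ij]})-\sum_{1\le i<j\le n}x_{ij}^2\,\mathrm{per}(X^{i,j}_{i,j}).$$
   Context: $\mathrm{per}(X)=\sum_{\alpha\in S_n}x_{1\alpha(1)}x_{2\alpha(2)}\cdots x_{n\alpha(n)}$. $X^{i,j}_{i,j}$ denotes the submatrix of $X$ obtained by deleting rows $i,j$ and columns $i,j$; the permanent of the empty ($0\times 0$) matrix is $1$. Symmetric means $x_{st}=x_{ts}$ (no complex conjugation). *)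

theory Defs
  imports Complex_Main "Jordan_Normal_Form.DL_Submatrix"
begin

(* Set to 0 for non-square matrices, the same convention as for det in Jordan_Normal_Form. *)
definition per :: "'a :: comm_semiring_1 mat \<Rightarrow> 'a" where
  "per A = (if dim_row A = dim_col A
     then \<Sum>p\<in>{p. p permutes {0..<dim_row A}}. \<Prod>i = 0..<dim_row A. A $$ (i, p i)
     else 0)"

lemma per_empty: "A \<in> carrier_mat 0 0 \<Longrightarrow> per A = 1"
  by (simp add: per_def)

definition symmetric_mat :: "'a mat \<Rightarrow> bool" where
  "symmetric_mat A \<longleftrightarrow> transpose_mat A = A"

(* X_[ij] *)
definition zero_sym_entry :: "'a :: zero mat \<Rightarrow> nat \<Rightarrow> nat \<Rightarrow> 'a mat" where
  "zero_sym_entry A i j = (A |\<^sub>m (i, j) \<mapsto> 0) |\<^sub>m (j, i) \<mapsto> 0"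

(* X^{i,j}_{i,j}; submatrix keeps the rows and columns whose indices lie in the given sets *)
definition delete_pair :: "'a mat \<Rightarrow> nat \<Rightarrow> nat \<Rightarrow> 'a mat" where
  "delete_pair A i j = submatrix A (- {i, j}) (- {i, j})"

end

theory Submission
  imports Defs
begin

text \<open>
  Expand every permanent over permutations \<open>p\<close> and compare coefficients of the weight
  \<open>w p = (\<Prod>k<n. X $$ (k, p k))\<close>. It survives in \<open>per X\<^sub>[\<^sub>i\<^sub>j\<^sub>]\<close> unless \<open>p i = j\<close> or \<open>p j = i\<close>.
  Each \<open>k\<close> rules out the unordered pair of \<open>k\<close> and \<open>p k\<close>, and two different \<open>k\<close> rule out the same
  pair exactly when they form a 2-cycle of \<open>p\<close>. Hence \<open>p\<close> survives for \<open>n(n+1)/2 - n + c p\<close> pairs,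
  where \<open>c p\<close> counts the 2-cycles of \<open>p\<close>; and the total weight of the permutations with the
  2-cycle \<open>(i j)\<close> is \<open>x\<^sub>i\<^sub>j\<^sup>2\<close> times the permanent of the matrix without the rows and columns
  \<open>i\<close> and \<open>j\<close>.
\<close>

lemma per_carrier:
  assumes "A \<in> carrier_mat n n"
  shows "per A = (\<Sum>p | p permutes {0..<n}. \<Prod>k = 0..<n. A $$ (k, p k))"
  using assms by (auto simp: per_def)

text \<open>Rows and columns are relabelled by the same \<open>f\<close>, so conjugation by
  \<open>f\<close> matches the permutations of the two index sets without changing weights. This
  lets the permanent of a submatrix be summed over permutations of the original indices.\<close>

lemma per_reindex:
  assumes A: "A \<in> carrier_mat m m" and f: "bij_betw f {0..<m} S"
    and eq: "\<And>i j. i < m \<Longrightarrow> j < m \<Longrightarrow> A $$ (i, j) = g (f i) (f j)"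
  shows "per A = (\<Sum>p | p permutes S. \<Prod>k\<in>S. g k (p k))"
proof -
  \<comment> \<open>\<open>?h q\<close> is the conjugate of \<open>q\<close> by \<open>f\<close>,
    extended by the identity outside \<open>S\<close>.\<close>
  let ?h = "\<lambda>q x. if x \<in> S then f (q (inv_into {0..<m} f x)) else x"
  have "(\<Sum>p | p permutes S. \<Prod>k\<in>S. g k (p k))
      = (\<Sum>q | q permutes {0..<m}. \<Prod>k\<in>S. g k (?h q k))"
    by (rule sum.reindex_bij_betw[OF bij_betw_permutations[OF f], symmetric])
  also have "\<dots> = (\<Sum>q | q permutes {0..<m}. \<Prod>k = 0..<m. A $$ (k, q k))"
  proof (rule sum.cong[OF refl])
    fix q assume "q \<in> {q. q permutes {0..<m}}"
    then have q: "q permutes {0..<m}" by simp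
    have "(\<Prod>k\<in>S. g k (?h q k)) = (\<Prod>k = 0..<m. g (f k) (?h q (f k)))"
      by (rule prod.reindex_bij_betw[OF f, symmetric])
    also have "\<dots> = (\<Prod>k = 0..<m. A $$ (k, q k))"
    proof (rule prod.cong[OF refl])
      fix k assume k: "k \<in> {0..<m}"
      then have "f k \<in> S" "inv_into {0..<m} f (f k) = k"
        using f by (auto simp: bij_betw_inv_into_left dest: bij_betwE)
      moreover have "q k < m" using permutes_in_image[OF q, of k] k by simp
      ultimately show "g (f k) (?h q (f k)) = A $$ (k, q k)"
        using eq[of k "q k"] k by simp
    qed
    finally show "(\<Prod>k\<in>S. g k (?h q k)) = (\<Prod>k = 0..<m. A $$ (k, q k))" .
  qed
  finally show ?thesis using per_carrier[OF A] by simp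
qed

lemma bij_betw_pick:
  "bij_betw (pick I) {0..<card {i. i < n \<and> i \<in> I}} {i. i < n \<and> i \<in> I}"
proof -
  let ?S = "{i. i < n \<and> i \<in> I}"
  have "inj_on (pick I) {0..<card ?S}"
  proof (rule inj_onI)
    fix x y assume "x \<in> {0..<card ?S}" "y \<in> {0..<card ?S}" "pick I x = pick I y"
    \<comment> \<open>\<open>I\<close> may be infinite (later it is the complement of
      \<open>{i, j}\<close>), so \<open>pick\<close> is first restricted to the finite
      \<open>?S\<close>. There the number of elements below \<open>pick ?S x\<close> is
      \<open>x\<close>, which recovers the index.\<close>
    then have *: "x < card ?S" "y < card ?S" "pick ?S x = pick ?S y"
      using pick_reduce_set[of x n I] pick_reduce_set[of y n I] by auto
    show "x = y"
      using card_pick_le[OF *(1)] card_pick_le[OF *(2)] *(3) by simp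
  qed
  moreover have "pick I ` {0..<card ?S} \<subseteq> ?S"
  proof clarify
    fix x assume "x \<in> {0..<card ?S}"
    then have x: "x < card ?S" by simp
    show "pick I x < n \<and> pick I x \<in> I"
      using pick_in_set_le[OF x] pick_reduce_set[OF x] by auto
  qed
  ultimately show ?thesis
    by (intro bij_betw_imageI card_subset_eq) (simp_all add: card_image)
qed

lemma per_submatrix:
  assumes "A \<in> carrier_mat n n"
  shows "per (submatrix A I I)
    = (\<Sum>p | p permutes {i. i < n \<and> i \<in> I}. \<Prod>k | k < n \<and> k \<in> I. A $$ (k, p k))"
  using assms
  by (intro per_reindex[OF _ bij_betw_pick]) (auto simp: dim_submatrix submatrix_index)

text \<open>Composing with the transposition turns a permutation fixing \<open>i\<close> and
  \<open>j\<close> into one exchanging them, and back: the transposition is an involution, so the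
  same map serves as inverse.\<close>

lemma bij_betw_permutes_two_cycle:
  assumes ij: "i \<in> S" "j \<in> S"
  shows "bij_betw (\<lambda>q. transpose i j \<circ> q) {q. q permutes (S - {i, j})}
    {p. p permutes S \<and> p i = j \<and> p j = i}"
proof (rule bij_betw_byWitness[where f' = "\<lambda>p. transpose i j \<circ> p"])
  show "(\<lambda>q. transpose i j \<circ> q) ` {q. q permutes (S - {i, j})}
      \<subseteq> {p. p permutes S \<and> p i = j \<and> p j = i}"
  proof (rule image_subsetI)
    fix q assume "q \<in> {q. q permutes (S - {i, j})}"
    then have q: "q permutes S - {i, j}" by simp
    have "transpose i j \<circ> q permutes S"
      using ij by (intro permutes_compose[OF permutes_subset[OF q]] permutes_swap_id) auto
    then show "transpose i j \<circ> q \<in> {p. p permutes S \<and> p i = j \<and> p j = i}"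
      using permutes_not_in[OF q] by simp
  qed
  show "(\<lambda>p. transpose i j \<circ> p) ` {p. p permutes S \<and> p i = j \<and> p j = i}
      \<subseteq> {q. q permutes (S - {i, j})}"
  proof (rule image_subsetI)
    fix p assume "p \<in> {p. p permutes S \<and> p i = j \<and> p j = i}"
    then have p: "p permutes S" "p i = j" "p j = i" by simp_all
    have "transpose i j \<circ> p permutes S"
      using p(1) ij by (intro permutes_compose permutes_swap_id)
    then have "transpose i j \<circ> p permutes S - {i, j}"
      by (rule permutes_superset) (use p in auto)
    then show "transpose i j \<circ> p \<in> {q. q permutes (S - {i, j})}" by simp
  qed
qed (auto simp: fun_eq_iff)

text \<open>Rows \<open>i\<close> and \<open>j\<close> contribute the two entries in front; the
  other factors are the weight of the permutation left on the remaining indices.\<close>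

lemma per_delete_pair:
  assumes A: "A \<in> carrier_mat n n" and ij: "i < n" "j < n" "i \<noteq> j"
  shows "A $$ (i, j) * A $$ (j, i) * per (delete_pair A i j)
    = (\<Sum>p | p permutes {0..<n} \<and> p i = j \<and> p j = i. \<Prod>k = 0..<n. A $$ (k, p k))"
proof -
  let ?T = "{0..<n} - {i, j}"
  have T: "{k. k < n \<and> k \<in> - {i, j}} = ?T" by auto
  have "(\<Sum>p | p permutes {0..<n} \<and> p i = j \<and> p j = i. \<Prod>k = 0..<n. A $$ (k, p k))
      = (\<Sum>q | q permutes ?T. \<Prod>k = 0..<n. A $$ (k, (transpose i j \<circ> q) k))"
    using ij by (intro sum.reindex_bij_betw[OF bij_betw_permutes_two_cycle, symmetric]) auto
  also have "\<dots> = (\<Sum>q | q permutes ?T.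
      A $$ (i, j) * A $$ (j, i) * (\<Prod>k\<in>?T. A $$ (k, q k)))"
  proof (rule sum.cong[OF refl])
    fix q assume "q \<in> {q. q permutes ?T}"
    then have q: "q permutes ?T" by simp
    let ?a = "\<lambda>k. A $$ (k, (transpose i j \<circ> q) k)"
    have "{0..<n} = insert i (insert j ?T)" using ij by auto
    then have "prod ?a {0..<n} = prod ?a (insert i (insert j ?T))" by simp
    also have "\<dots> = ?a i * (?a j * prod ?a ?T)" using ij by simp
    also have "?a i = A $$ (i, j)" using permutes_not_in[OF q] by simp
    also have "?a j = A $$ (j, i)" using permutes_not_in[OF q] by simp
    also have "prod ?a ?T = (\<Prod>k\<in>?T. A $$ (k, q k))"
    proof (rule prod.cong[OF refl])
      fix k assume "k \<in> ?T"
      then have "q k \<in> ?T" using permutes_in_image[OF q] by blast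
      then show "?a k = A $$ (k, q k)" by auto
    qed
    finally show "prod ?a {0..<n} = A $$ (i, j) * A $$ (j, i) * (\<Prod>k\<in>?T. A $$ (k, q k))"
      by (simp add: mult.assoc)
  qed
  also have "\<dots> = A $$ (i, j) * A $$ (j, i) * per (delete_pair A i j)"
    unfolding delete_pair_def per_submatrix[OF A] T by (simp add: sum_distrib_left)
  finally show ?thesis by simp
qed

text \<open>A weight meets a zeroed position exactly when \<open>p i = j\<close> or
  \<open>p j = i\<close>. Then a factor vanishes; otherwise no factor changes. For
  \<open>i = j\<close> both conditions say that \<open>p\<close> fixes \<open>i\<close>.\<close>

lemma per_zero_sym_entry:
  assumes A: "A \<in> carrier_mat n n" and ij: "i < n" "j < n"
  shows "per (zero_sym_entry A i j)
    = (\<Sum>p | p permutes {0..<n}. of_bool (p i \<noteq> j \<and> p j \<noteq> i) * (\<Prod>k = 0..<n. A $$ (k, p k)))"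
proof -
  let ?Z = "zero_sym_entry A i j"
  have "?Z \<in> carrier_mat n n" using A by (auto simp: zero_sym_entry_def)
  moreover have "(\<Prod>k = 0..<n. ?Z $$ (k, p k))
      = of_bool (p i \<noteq> j \<and> p j \<noteq> i) * (\<Prod>k = 0..<n. A $$ (k, p k))"
    if p: "p permutes {0..<n}" for p
  proof -
    have Z: "?Z $$ (k, p k)
        = (if k = i \<and> p k = j \<or> k = j \<and> p k = i then 0 else A $$ (k, p k))"
      if "k \<in> {0..<n}" for k
    proof -
      have "p k < n" using permutes_in_image[OF p, of k] that by simp
      then show ?thesis
        using A that by (auto simp: zero_sym_entry_def update_mat_def)
    qed
    show ?thesis
    proof (cases "p i \<noteq> j \<and> p j \<noteq> i")
      case True
      then show ?thesis by (auto simp: Z intro!: prod.cong)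
    next
      case False
      then have "\<exists>k\<in>{0..<n}. ?Z $$ (k, p k) = 0"
        using ij Z[of i] Z[of j] by auto
      then have "(\<Prod>k = 0..<n. ?Z $$ (k, p k)) = 0" by (intro prod_zero) simp_all
      then show ?thesis using False by auto
    qed
  qed
  ultimately show ?thesis by (simp add: per_carrier del: of_bool_conj)
qed

lemma sum_le_pairs_eq:
  fixes f :: "nat \<Rightarrow> nat \<Rightarrow> 'a :: comm_monoid_add"
  shows "(\<Sum>(i, j) | i \<le> j \<and> j < n. f i j) = (\<Sum>(i, j) | i < j \<and> j < n. f i j) + (\<Sum>i<n. f i i)"
proof -
  let ?L = "{(i, j). i < j \<and> j < n}" and ?D = "(\<lambda>i. (i, i)) ` {..<n}"
  have "{(i, j). i \<le> j \<and> j < n} = ?L \<union> ?D" by auto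
  moreover have "finite ?L" by (rule finite_subset[of _ "{..<n} \<times> {..<n}"]) auto
  moreover have "?L \<inter> ?D = {}" by auto
  moreover have "(\<Sum>(i, j)\<in>?D. f i j) = (\<Sum>i<n. f i i)"
    by (subst sum.reindex) (auto simp: inj_on_def)
  ultimately show ?thesis by (simp add: sum.union_disjoint)
qed

lemma sum_square_pairs_eq:
  fixes f :: "nat \<Rightarrow> nat \<Rightarrow> 'a :: comm_monoid_add"
  shows "(\<Sum>i<n. \<Sum>j<n. f i j) = (\<Sum>(i, j) | i < j \<and> j < n. f i j + f j i) + (\<Sum>i<n. f i i)"
proof -
  let ?L = "{(i, j). i < j \<and> j < n}" and ?D = "{(i, j). i \<le> j \<and> j < n}"
  have fin: "finite ?L" "finite ?D"
    by (rule finite_subset[of _ "{..<n} \<times> {..<n}"]; auto)+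
  have "(\<Sum>i<n. \<Sum>j<n. f i j) = (\<Sum>(i, j)\<in>{..<n} \<times> {..<n}. f i j)"
    by (simp add: sum.cartesian_product)
  \<comment> \<open>The strict lower triangle is the mirror image of \<open>?L\<close>, hence the
    swapped arguments in \<open>f j i\<close>.\<close>
  also have "{..<n} \<times> {..<n} = ?D \<union> prod.swap ` ?L" by (auto simp: image_iff)
  also have "(\<Sum>(i, j)\<in>\<dots>. f i j) = (\<Sum>(i, j)\<in>?D. f i j) + (\<Sum>(i, j)\<in>prod.swap ` ?L. f i j)"
    using fin by (intro sum.union_disjoint) auto
  also have "(\<Sum>(i, j)\<in>prod.swap ` ?L. f i j) = (\<Sum>(i, j)\<in>?L. f j i)"
    by (subst sum.reindex) (auto simp: case_prod_unfold)
  finally show ?thesis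
    unfolding sum_le_pairs_eq by (simp add: sum.distrib case_prod_unfold ac_simps)
qed

lemma permutation_pair_count:
  fixes p :: "nat \<Rightarrow> nat"
  assumes p: "p permutes {0..<n}"
  shows "(\<Sum>(i, j) | i \<le> j \<and> j < n. of_bool (p i \<noteq> j \<and> p j \<noteq> i) :: complex)
    = 1 / 2 * ((of_nat n)\<^sup>2 - of_nat n) + (\<Sum>(i, j) | i < j \<and> j < n. of_bool (p i = j \<and> p j = i))"
proof -
  let ?L = "{(i, j). i < j \<and> j < n}"
  \<comment> \<open>\<open>?e\<close> is the permutation matrix of \<open>p\<close>; each row sums
    to 1, so its total is \<open>n\<close>.\<close>
  let ?e = "\<lambda>i j. of_bool (p i = j) :: complex"
  have "(\<Sum>i<n. \<Sum>j<n. ?e i j) = (\<Sum>i<n. 1)"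
  proof (rule sum.cong[OF refl])
    fix i assume "i \<in> {..<n}"
    then have "p i \<in> {..<n}" using permutes_in_image[OF p, of i] by simp
    then show "(\<Sum>j<n. ?e i j) = 1" by (simp add: of_bool_def sum.delta)
  qed
  then have e: "(\<Sum>(i, j)\<in>?L. ?e i j + ?e j i) + (\<Sum>i<n. ?e i i) = of_nat n"
    unfolding sum_square_pairs_eq by simp
  have "(\<Sum>(i, j)\<in>?L. 2 :: complex) + (\<Sum>i<n. 1) = (of_nat n)\<^sup>2"
    using sum_square_pairs_eq[of "\<lambda>_ _. 1 :: complex" n] by (simp add: power2_eq_square)
  then have c: "(\<Sum>(i, j)\<in>?L. 1 :: complex) = 1 / 2 * ((of_nat n)\<^sup>2 - of_nat n)"
    by (simp add: field_simps)
  \<comment> \<open>Inclusion-exclusion for the events \<open>p i = j\<close> and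
    \<open>p j = i\<close>. On the diagonal they coincide, so only one term is subtracted
    there.\<close>
  have "(\<Sum>(i, j) | i \<le> j \<and> j < n. of_bool (p i \<noteq> j \<and> p j \<noteq> i) :: complex)
      = (\<Sum>(i, j)\<in>?L. 1 + of_bool (p i = j \<and> p j = i) - (?e i j + ?e j i)) + (\<Sum>i<n. 1 - ?e i i)"
    unfolding sum_le_pairs_eq by (intro arg_cong2[where f = "(+)"] sum.cong) auto
  \<comment> \<open>The final \<open>of_nat n\<close> counts the diagonal pairs and cancels the
    total of \<open>?e\<close>, leaving the strict pairs and the 2-cycles.\<close>
  also have "\<dots> = (\<Sum>(i, j)\<in>?L. 1) + (\<Sum>(i, j)\<in>?L. of_bool (p i = j \<and> p j = i))
      - ((\<Sum>(i, j)\<in>?L. ?e i j + ?e j i) + (\<Sum>i<n. ?e i i)) + of_nat n"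
    by (simp add: case_prod_unfold sum.distrib sum_subtractf)
  finally show ?thesis unfolding e c by simp
qed

theorem theorem2p2:
  fixes X :: "complex mat" and n :: nat
  assumes "X \<in> carrier_mat n n"
    and "symmetric_mat X"
  shows "1 / 2 * ((of_nat n)\<^sup>2 - of_nat n) * per X =
    (\<Sum>(i, j)\<in>{(i, j). i \<le> j \<and> j < n}. per (zero_sym_entry X i j))
    - (\<Sum>(i, j)\<in>{(i, j). i < j \<and> j < n}. (X $$ (i, j))\<^sup>2 * per (delete_pair X i j))"
proof -
  let ?P = "{p. p permutes {0..<n}}" and ?w = "\<lambda>p. \<Prod>k = 0..<n. X $$ (k, p k)"
  let ?L = "{(i, j). i < j \<and> j < n}" and ?D = "{(i, j). i \<le> j \<and> j < n}"
  have fin: "finite ?P" by (simp add: finite_permutations)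
  have sym: "X $$ (j, i) = X $$ (i, j)" if "i < n" "j < n" for i j
    using assms that by (metis carrier_matD index_transpose_mat(1) symmetric_mat_def)
  have "(\<Sum>(i, j)\<in>?D. per (zero_sym_entry X i j))
      = (\<Sum>(i, j)\<in>?D. \<Sum>p\<in>?P. of_bool (p i \<noteq> j \<and> p j \<noteq> i) * ?w p)"
    using assms(1) by (intro sum.cong) (auto simp: per_zero_sym_entry)
  also have "\<dots> = (\<Sum>p\<in>?P. (\<Sum>(i, j)\<in>?D. of_bool (p i \<noteq> j \<and> p j \<noteq> i)) * ?w p)"
    unfolding case_prod_unfold sum_distrib_right by (rule sum.swap)
  also have "\<dots> = (\<Sum>p\<in>?P. (1 / 2 * ((of_nat n)\<^sup>2 - of_nat n)
      + (\<Sum>(i, j)\<in>?L. of_bool (p i = j \<and> p j = i))) * ?w p)"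
    by (intro sum.cong) (auto simp only: permutation_pair_count mem_Collect_eq)
  also have "\<dots> = 1 / 2 * ((of_nat n)\<^sup>2 - of_nat n) * per X
      + (\<Sum>p\<in>?P. (\<Sum>(i, j)\<in>?L. of_bool (p i = j \<and> p j = i)) * ?w p)"
    by (simp only: distrib_right sum.distrib sum_distrib_left per_carrier[OF assms(1)])
  also have "(\<Sum>p\<in>?P. (\<Sum>(i, j)\<in>?L. of_bool (p i = j \<and> p j = i)) * ?w p)
      = (\<Sum>(i, j)\<in>?L. \<Sum>p\<in>?P. of_bool (p i = j \<and> p j = i) * ?w p)"
    unfolding case_prod_unfold sum_distrib_right by (rule sum.swap)
  also have "\<dots> = (\<Sum>(i, j)\<in>?L. (X $$ (i, j))\<^sup>2 * per (delete_pair X i j))"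
  proof (rule sum.cong[OF refl], clarify)
    fix i j assume ij: "i < j" "j < n"
    have "(\<Sum>p\<in>?P. of_bool (p i = j \<and> p j = i) * ?w p)
        = (\<Sum>p | p permutes {0..<n} \<and> p i = j \<and> p j = i. ?w p)"
      using fin by (intro sum.mono_neutral_cong_right) auto
    then show "(\<Sum>p\<in>?P. of_bool (p i = j \<and> p j = i) * ?w p)
        = (X $$ (i, j))\<^sup>2 * per (delete_pair X i j)"
      \<comment> \<open>Symmetry enters here: it turns the product of the entries at
        \<open>(i, j)\<close> and \<open>(j, i)\<close> into a square.\<close>
      using per_delete_pair[OF assms(1), of i j] ij sym[of i j] by (simp add: power2_eq_square)
  qed
  finally show ?thesis by simp
qed

end
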